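(* Let $\alpha\in(-\infty,0)$ and let $f:\mathbf{R}\to[0,\infty]$ be an $\alpha$-concave function. Then $$\int_{\mathbf{R}}\Delta_\alpha f\,dx\le 2\int_{\mathbf{R}}f\,dx\quad\text{if }\alpha\in(-1,0),$$ $$\int_{\mathbf{R}}\Delta_\alpha f\,dx\le \frac{1}{2^{1/\alpha}}\int_{\mathbf{R}}f\,dx\quad\text{if }\alpha\in(-\infty,-1].$$ Both inequalities are optimal, i.e. for every $\alpha\in(-1,0)$ there exists an $\alpha$-concave function $f$ for which equality holds in the first inequality, and for every $\alpha\in(-\infty,-1]$ there exists an $\alpha$-concave function $f$ for which equality holds in the second inequality.
   Context: For $\alpha\in(-\infty,0)$, $a,b\in[0,\infty]$ and $t\in[0,1]$, the mean of order $\alpha$ is $M_\alpha(a,b;t)=\left(ta^\alpha+(1-t)b^\alpha\right)^{1/\alpha}$ if $a\ne0$ and $b\ne0$ (with the conventions $\infty^\alpha=0$ and $0^{1/\alpha}=\infty$; in particular $M_\alpha(\infty,c;\tfrac12)=M_\alpha(c,\infty;\tfrac12)=c/2^{1/\alpha}$ and $M_\alpha(\infty,\infty;t)=\infty$), and $M_\alpha(a,b;t)=0$ if either $a=0$ or $b=0$. A function $f:\mathbf{R}\to[0,\infty]$ is $\alpha$-concave if $f(tx+(1-t)y)\ge M_\alpha(f(x),f(y);t)$ for all $x,y\in\mathbf{R}$ and all $t\in[0,1]$. The difference function of order $\alpha$ of $f:\mathbf{R}\to[0,\infty]$ is $$\Delta_\alpha f(z)=\sup\left\{M_\alpha\left(f(x),f(-y);\tfrac12\right)\;:\;x,y\in\mathbf{R},\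 \tfrac12(x+y)=z\right\},\quad z\in\mathbf{R}.$$ Integrals are with respect to Lebesgue measure and take values in $[0,\infty]$. *)

theory Defs
  imports "HOL-Analysis.Analysis"
begin

(* The power x^p on [0,\<infinity>] for an exponent p < 0, where 0^p = \<infinity> and \<infinity>^p = 0.
   The value is meaningful for p < 0 only. *)
definition ennreal_neg_powr :: "ennreal \<Rightarrow> real \<Rightarrow> ennreal" where
  "ennreal_neg_powr x p =
     (if x = 0 then \<infinity> else if x = \<infinity> then 0 else ennreal (enn2real x powr p))"

definition mean_of_order :: "real \<Rightarrow> ennreal \<Rightarrow> ennreal \<Rightarrow> real \<Rightarrow> ennreal" where
  "mean_of_order \<alpha> a b t =
     (if a = 0 \<or> b = 0 then 0
      else ennreal_neg_powr
             (ennreal t * ennreal_neg_powr a \<alpha> + ennreal (1 - t) * ennreal_neg_powr b \<alpha>)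
             (1 / \<alpha>))"

definition alpha_concave :: "real \<Rightarrow> (real \<Rightarrow> ennreal) \<Rightarrow> bool" where
  "alpha_concave \<alpha> f \<longleftrightarrow>
     (\<forall>x y. \<forall>t\<in>{0..1}. f (t * x + (1 - t) * y) \<ge> mean_of_order \<alpha> (f x) (f y) t)"

definition difference_function :: "real \<Rightarrow> (real \<Rightarrow> ennreal) \<Rightarrow> real \<Rightarrow> ennreal" where
  "difference_function \<alpha> f z =
     Sup {mean_of_order \<alpha> (f x) (f (- y)) (1/2) | x y. (x + y) / 2 = z}"

end

(* In terms of g = f^\<alpha>, a convex function, \<Delta>f > s at z means that (g(u) + g(v)) / 2 < s^\<alpha> for some
   u - v = 2z. By convexity the midpoint (u + v)/2 and one of u, v lie in the interval {f > s}, which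
   therefore has length at least |z|; also both u and v lie in {f > 2^(1/\<alpha>) s}, which therefore has
   length at least 2|z|. Integrating the lengths of the superlevel sets over s gives the constants 2
   and 2^(-1/\<alpha>), both valid for all \<alpha> < 0. Equality holds for f(x) = (1 + x)^(1/\<alpha>) on x \<ge> 0 and for
   f(x) = x^(1/\<alpha>) on [0,1], respectively. *)
theory Submission
  imports Defs
begin

section \<open>Powers with a negative exponent on the extended half-line\<close>

lemma ennreal_neg_powr_antimono:
  assumes "p < 0" "x \<le> y"
  shows "ennreal_neg_powr y p \<le> ennreal_neg_powr x p"
proof (cases "x = 0 \<or> y = \<infinity>")
  case False
  then obtain r s where "x = ennreal r" "y = ennreal s" "r > 0" "s \<ge> r"
    using assms(2) by (cases x; cases y) (auto simp: less_le top_unique)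
  with assms show ?thesis
    by (auto simp: ennreal_neg_powr_def intro!: ennreal_leI powr_mono2')
qed (use assms in \<open>auto simp: ennreal_neg_powr_def\<close>)

text \<open>The conventions for 0 and infinity swap these two values, so the two powers cancel at
  the endpoints as well.\<close>

lemma ennreal_neg_powr_inverse:
  assumes "\<alpha> \<noteq> 0"
  shows "ennreal_neg_powr (ennreal_neg_powr x \<alpha>) (1 / \<alpha>) = x"
proof (cases "x = 0 \<or> x = \<infinity>")
  case False
  then obtain r where "x = ennreal r" "r > 0"
    by (cases x) (auto simp: less_le)
  with assms show ?thesis
    by (auto simp: ennreal_neg_powr_def powr_powr)
qed (auto simp: ennreal_neg_powr_def)

lemma ennreal_neg_powr_cmult:
  assumes "c > 0"
  shows "ennreal_neg_powr (ennreal c * x) p = ennreal (c powr p) * ennreal_neg_powr x p"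
proof (cases "x = 0 \<or> x = \<infinity>")
  case False
  then obtain r where "x = ennreal r" "r > 0"
    by (cases x) (auto simp: less_le)
  with assms show ?thesis
    by (auto simp: ennreal_neg_powr_def powr_mult ennreal_mult[symmetric])
qed (use assms in \<open>auto simp: ennreal_neg_powr_def ennreal_mult_top\<close>)

lemma borel_measurable_ennreal_neg_powr [measurable (raw)]:
  assumes [measurable]: "f \<in> borel_measurable M"
  shows "(\<lambda>x. ennreal_neg_powr (f x) p) \<in> borel_measurable M"
  unfolding ennreal_neg_powr_def by measurable

section \<open>Elementary bounds for the mean of order \<alpha>\<close>

lemma convex_combination_const_ennreal:
  fixes a :: ennreal
  assumes "t \<in> {0..1}"
  shows "ennreal t * a + ennreal (1 - t) * a = a"
  using assms by (simp flip: distrib_right ennreal_plus)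

text \<open>Replacing both arguments by the smaller one raises the combination of \<alpha>-th
  powers; the negative exponent \<open>1 / \<alpha>\<close> reverses the order a second
  time.\<close>

lemma mean_of_order_ge_min:
  assumes "\<alpha> < 0" "t \<in> {0..1}"
  shows "min a b \<le> mean_of_order \<alpha> a b t"
proof (cases "a = 0 \<or> b = 0")
  case False
  let ?P = "\<lambda>x. ennreal_neg_powr x \<alpha>"
  have "ennreal t * ?P a + ennreal (1 - t) * ?P b
      \<le> ennreal t * ?P (min a b) + ennreal (1 - t) * ?P (min a b)"
    using assms by (intro add_mono mult_left_mono ennreal_neg_powr_antimono) auto
  also have "\<dots> = ?P (min a b)"
    by (rule convex_combination_const_ennreal[OF assms(2)])
  finally have "ennreal_neg_powr (?P (min a b)) (1 / \<alpha>) \<le> mean_of_order \<alpha> a b t"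
    using False assms by (auto simp: mean_of_order_def intro!: ennreal_neg_powr_antimono)
  then show ?thesis
    using assms by (simp add: ennreal_neg_powr_inverse)
qed auto

lemma mean_of_order_le_max:
  assumes "\<alpha> < 0" "t \<in> {0..1}"
  shows "mean_of_order \<alpha> a b t \<le> max a b"
proof (cases "a = 0 \<or> b = 0")
  case True
  then show ?thesis by (simp add: mean_of_order_def)
next
  case False
  let ?P = "\<lambda>x. ennreal_neg_powr x \<alpha>"
  have "?P (max a b) = ennreal t * ?P (max a b) + ennreal (1 - t) * ?P (max a b)"
    by (rule convex_combination_const_ennreal[OF assms(2), symmetric])
  also have "\<dots> \<le> ennreal t * ?P a + ennreal (1 - t) * ?P b"
    using assms by (intro add_mono mult_left_mono ennreal_neg_powr_antimono) auto
  finally have "mean_of_order \<alpha> a b t \<le> ennreal_neg_powr (?P (max a b)) (1 / \<alpha>)"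
    using False assms by (auto simp: mean_of_order_def intro!: ennreal_neg_powr_antimono)
  then show ?thesis
    using assms by (simp add: ennreal_neg_powr_inverse)
qed

lemma mean_of_order_half_commute: "mean_of_order \<alpha> a b (1/2) = mean_of_order \<alpha> b a (1/2)"
  by (auto simp: mean_of_order_def add.commute)

text \<open>Dropping the term of \<open>b\<close> lowers the combination of powers and hence raises
  the mean; the remaining weight 1/2 comes out as (1/2)^(1/\<alpha>).\<close>

lemma mean_of_order_half_le_cmult:
  assumes "\<alpha> < 0"
  shows "mean_of_order \<alpha> a b (1/2) \<le> ennreal (1 / 2 powr (1 / \<alpha>)) * a"
proof (cases "a = 0 \<or> b = 0")
  case True
  then show ?thesis by (auto simp: mean_of_order_def)
next
  case False
  let ?P = "\<lambda>x. ennreal_neg_powr x \<alpha>"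
  have "mean_of_order \<alpha> a b (1/2) \<le> ennreal_neg_powr (ennreal (1/2) * ?P a) (1 / \<alpha>)"
    using False assms by (auto simp: mean_of_order_def intro!: ennreal_neg_powr_antimono)
  also have "\<dots> = ennreal ((1/2) powr (1 / \<alpha>)) * a"
    using assms by (simp add: ennreal_neg_powr_cmult ennreal_neg_powr_inverse del: ennreal_half)
  also have "(1/2) powr (1 / \<alpha>) = 1 / 2 powr (1 / \<alpha>)"
    by (simp add: powr_divide)
  finally show ?thesis .
qed

section \<open>Quasi-concavity and measurability\<close>

definition quasi_concave :: "(real \<Rightarrow> ennreal) \<Rightarrow> bool" where
  "quasi_concave f \<longleftrightarrow> (\<forall>s. convex {x. s < f x})"

lemma alpha_concave_imp_quasi_concave:
  assumes "\<alpha> < 0" "alpha_concave \<alpha> f"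
  shows "quasi_concave f"
  unfolding quasi_concave_def
proof (intro allI convexI)
  fix s :: ennreal and x y u v :: real
  assume xy: "x \<in> {x. s < f x}" "y \<in> {x. s < f x}" and uv: "0 \<le> u" "0 \<le> v" "u + v = 1"
  then have u: "u \<in> {0..1}" "v = 1 - u" by auto
  have "s < min (f x) (f y)" using xy by auto
  also have "\<dots> \<le> mean_of_order \<alpha> (f x) (f y) u"
    using assms u by (intro mean_of_order_ge_min)
  also have "\<dots> \<le> f (u * x + (1 - u) * y)"
    using assms u by (auto simp: alpha_concave_def)
  finally show "u *\<^sub>R x + v *\<^sub>R y \<in> {x. s < f x}"
    by (simp add: u)
qed

text \<open>Convex subsets of the line are intervals, hence Borel. In this way \<alpha>-concavity
  itself supplies the measurability of \<open>f\<close>.\<close>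

lemma quasi_concave_borel_measurable:
  assumes "quasi_concave f"
  shows "f \<in> borel_measurable borel"
proof (rule borel_measurableI_greater)
  fix s :: ennreal
  have "is_interval {x. s < f x}"
    using assms by (auto simp: quasi_concave_def is_interval_convex_1)
  then show "{x \<in> space borel. s < f x} \<in> sets borel"
    using real_interval_borel_measurable by simp
qed

section \<open>Integration over superlevel sets\<close>

lemma emeasure_lborel_atLeast [simp]: "emeasure lborel {a::real..} = \<infinity>"
proof (rule ccontr)
  assume "emeasure lborel {a..} \<noteq> \<infinity>"
  then obtain n where n: "emeasure lborel {a..} < of_nat n"
    using ennreal_Ex_less_of_nat by (auto simp: less_top)
  have "emeasure lborel {a..a + real n} \<le> emeasure lborel {a..}"
    by (rule emeasure_mono) auto
  with n show False
    by (simp add: ennreal_of_nat_eq_real_of_nat)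
qed

text \<open>Tonelli for the region under the graph: the slice over \<open>x\<close> has length
  \<open>f x\<close> (a half-line where \<open>f x\<close> is infinite), and the slice at height
  \<open>s\<close> is a superlevel set. Since \<open>ennreal s\<close> is 0 for negative
  \<open>s\<close>, the indicator must exclude such heights.\<close>

lemma nn_integral_layer_cake:
  fixes f :: "real \<Rightarrow> ennreal"
  assumes [measurable]: "f \<in> borel_measurable borel"
  shows "(\<integral>\<^sup>+x. f x \<partial>lborel)
    = (\<integral>\<^sup>+s. emeasure lborel {x. ennreal s < f x} * indicator {0..} s \<partial>lborel)"
proof -
  have slice: "(\<integral>\<^sup>+s. indicator {s. 0 \<le> s \<and> ennreal s < a} s \<partial>lborel) = a" for a
  proof (cases a)
    case (real r)
    then have "{s. 0 \<le> s \<and> ennreal s < a} = {0..<r}"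
      by (auto simp: ennreal_less_iff)
    with real show ?thesis by simp
  next
    case top
    then have "{s. 0 \<le> s \<and> ennreal s < a} = {0::real..}"
      by (auto simp: ennreal_less_top)
    with top show ?thesis by simp
  qed
  have "(\<integral>\<^sup>+x. f x \<partial>lborel)
      = (\<integral>\<^sup>+x. (\<integral>\<^sup>+s. indicator {s. 0 \<le> s \<and> ennreal s < f x} s \<partial>lborel) \<partial>lborel)"
    by (simp only: slice)
  also have "\<dots> = (\<integral>\<^sup>+s. (\<integral>\<^sup>+x. indicator {s. 0 \<le> s \<and> ennreal s < f x} s \<partial>lborel) \<partial>lborel)"
  proof (rule lborel_pair.Fubini'[symmetric])
    have "(\<lambda>p. indicator {p. 0 \<le> snd p \<and> ennreal (snd p) < f (fst p)} p :: ennreal)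
        \<in> borel_measurable (lborel \<Otimes>\<^sub>M lborel)"
      by measurable
    then show "(\<lambda>(x, s). indicator {s. 0 \<le> s \<and> ennreal s < f x} s :: ennreal)
        \<in> borel_measurable (lborel \<Otimes>\<^sub>M lborel)"
      by (simp add: indicator_def case_prod_beta')
  qed
  also have "\<dots> = (\<integral>\<^sup>+s. emeasure lborel {x. ennreal s < f x} * indicator {0..} s \<partial>lborel)"
  proof (rule nn_integral_cong)
    fix s :: real
    have "(\<integral>\<^sup>+x. indicator {s. 0 \<le> s \<and> ennreal s < f x} s \<partial>lborel)
        = (\<integral>\<^sup>+x. indicator {x. ennreal s < f x} x * indicator {0..} s \<partial>lborel)"
      by (rule nn_integral_cong) (auto simp: indicator_def)
    then show "(\<integral>\<^sup>+x. indicator {s. 0 \<le> s \<and> ennreal s < f x} s \<partial>lborel)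
        = emeasure lborel {x. ennreal s < f x} * indicator {0..} s"
      by (simp add: nn_integral_multc)
  qed
  finally show ?thesis .
qed

text \<open>The set is the interval from -W to W; this is the source of the factor 2 in the next
  lemma.\<close>

lemma emeasure_abs_le: "emeasure lborel {z::real. ennreal \<bar>z\<bar> \<le> W} \<le> 2 * W"
proof (cases W)
  case (real w)
  then have "{z::real. ennreal \<bar>z\<bar> \<le> W} = {-w..w}"
    by auto
  with real show ?thesis
    by (simp add: ennreal_mult'' flip: ennreal_numeral)
qed (simp add: ennreal_mult_top)

text \<open>Only measurable minorants of \<open>D\<close> enter its upper integral, so \<open>D\<close> itself need not be
  measurable.\<close>
lemma nn_integral_le_of_symmetric_superlevel_bound:
  fixes D f :: "real \<Rightarrow> ennreal"
  assumes [measurable]: "f \<in> borel_measurable borel"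
    and bound: "\<And>s z. 0 \<le> s \<Longrightarrow> ennreal s < D z \<Longrightarrow>
      ennreal \<bar>z\<bar> \<le> C * emeasure lborel {x. ennreal s < f x}"
  shows "(\<integral>\<^sup>+z. D z \<partial>lborel) \<le> 2 * C * (\<integral>\<^sup>+x. f x \<partial>lborel)"
  unfolding nn_integral_def[of lborel D]
proof (rule SUP_least)
  fix g assume "g \<in> {g. simple_function lborel g \<and> g \<le> D}"
  then have g: "simple_function lborel g" "g \<le> D" by auto
  then have [measurable]: "g \<in> borel_measurable borel"
    using borel_measurable_simple_function by fastforce
  let ?W = "\<lambda>s. emeasure lborel {x. ennreal s < f x}"
  \<comment> \<open>\<open>?W s\<close> is the measure of the section at \<open>s\<close> of a
    measurable subset of the plane.\<close>
  have [measurable]: "(\<lambda>s. ?W s) \<in> borel_measurable borel"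
  proof -
    have "{p \<in> space (borel \<Otimes>\<^sub>M lborel). ennreal (fst p) < f (snd p)} \<in> sets (borel \<Otimes>\<^sub>M lborel)"
      by measurable
    then have "(\<lambda>s. emeasure lborel (Pair s -` {p \<in> space (borel \<Otimes>\<^sub>M lborel). ennreal (fst p) < f (snd p)}))
        \<in> borel_measurable borel"
      by (rule lborel.measurable_emeasure_Pair)
    then show ?thesis by (simp add: vimage_def space_pair_measure)
  qed
  have "integral\<^sup>S lborel g = (\<integral>\<^sup>+z. g z \<partial>lborel)"
    using g by (simp add: nn_integral_eq_simple_integral)
  also have "\<dots> = (\<integral>\<^sup>+s. emeasure lborel {z. ennreal s < g z} * indicator {0..} s \<partial>lborel)"
    by (rule nn_integral_layer_cake) measurable
  also have "\<dots> \<le> (\<integral>\<^sup>+s. 2 * C * (?W s * indicator {0..} s) \<partial>lborel)"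
  proof (rule nn_integral_mono)
    fix s :: real
    show "emeasure lborel {z. ennreal s < g z} * indicator {0..} s \<le> 2 * C * (?W s * indicator {0..} s)"
    proof (cases "0 \<le> s")
      case True
      \<comment> \<open>The minorant \<open>g\<close> inherits the bound from \<open>D\<close>, and
        its superlevel sets are measurable.\<close>
      have "{z. ennreal s < g z} \<subseteq> {z. ennreal \<bar>z\<bar> \<le> C * ?W s}"
        using g(2) bound[OF True] by (auto simp: le_fun_def intro: less_le_trans)
      then have "emeasure lborel {z. ennreal s < g z} \<le> emeasure lborel {z. ennreal \<bar>z\<bar> \<le> C * ?W s}"
        by (rule emeasure_mono) measurable
      also have "\<dots> \<le> 2 * (C * ?W s)" by (rule emeasure_abs_le)
      finally show ?thesis using True by (simp add: mult_ac)
    qed simp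
  qed
  also have "\<dots> = 2 * C * (\<integral>\<^sup>+x. f x \<partial>lborel)"
    by (subst nn_integral_cmult) (simp_all add: nn_integral_layer_cake[of f])
  finally show "integral\<^sup>S lborel g \<le> 2 * C * (\<integral>\<^sup>+x. f x \<partial>lborel)" .
qed

section \<open>The two upper bounds\<close>

text \<open>The points \<open>x\<close> and \<open>-y\<close> differ by 2z. If z is negative they
  are exchanged, which the mean with weight 1/2 does not notice.\<close>

lemma difference_function_greaterE:
  assumes "s < difference_function \<alpha> f z"
  obtains u v where "v \<le> u" "u - v = 2 * \<bar>z\<bar>" "s < mean_of_order \<alpha> (f u) (f v) (1/2)"
proof -
  from assms obtain x y where xy: "(x + y) / 2 = z" "s < mean_of_order \<alpha> (f x) (f (- y)) (1/2)"
    unfolding difference_function_def less_Sup_iff by blast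
  show thesis
  proof (cases "z \<ge> 0")
    case True
    with xy show ?thesis by (intro that[of "-y" x]) auto
  next
    case False
    with xy show ?thesis
      by (intro that[of x "-y"]) (auto simp: mean_of_order_half_commute)
  qed
qed

text \<open>The superlevel set is an interval, so it contains the whole segment
  \<open>{v..u}\<close>.\<close>

lemma emeasure_superlevel_ge:
  assumes "quasi_concave f" "s < f v" "s < f u" "v \<le> u"
  shows "ennreal (u - v) \<le> emeasure lborel {x. s < f x}"
proof -
  have [measurable]: "f \<in> borel_measurable borel"
    by (rule quasi_concave_borel_measurable) fact
  have "is_interval {x. s < f x}"
    using assms by (auto simp: quasi_concave_def is_interval_convex_1)
  then have "{v..u} \<subseteq> {x. s < f x}"
    using assms mem_is_interval_1_I[of "{x. s < f x}" v u] by auto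
  then have "emeasure lborel {v..u} \<le> emeasure lborel {x. s < f x}"
    by (rule emeasure_mono) measurable
  then show ?thesis using assms by simp
qed

lemma nn_integral_difference_function_le_2:
  assumes "\<alpha> < 0" "alpha_concave \<alpha> f"
  shows "(\<integral>\<^sup>+x. difference_function \<alpha> f x \<partial>lborel) \<le> 2 * (\<integral>\<^sup>+x. f x \<partial>lborel)"
proof -
  have qc: "quasi_concave f" using assms by (rule alpha_concave_imp_quasi_concave)
  \<comment> \<open>Here \<open>C = 1\<close>: the superlevel set of \<open>f\<close> has length at
    least |z|.\<close>
  have "(\<integral>\<^sup>+x. difference_function \<alpha> f x \<partial>lborel) \<le> 2 * 1 * (\<integral>\<^sup>+x. f x \<partial>lborel)"
  proof (rule nn_integral_le_of_symmetric_superlevel_bound)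
    show "f \<in> borel_measurable borel" using qc by (rule quasi_concave_borel_measurable)
  next
    fix s z assume "ennreal s < difference_function \<alpha> f z"
    then obtain u v where uv: "v \<le> u" "u - v = 2 * \<bar>z\<bar>"
      "ennreal s < mean_of_order \<alpha> (f u) (f v) (1/2)"
      by (rule difference_function_greaterE)
    note uv(3)
    also have "mean_of_order \<alpha> (f u) (f v) (1/2) \<le> f (1/2 * u + (1 - 1/2) * v)"
      using assms(2)[unfolded alpha_concave_def, rule_format, of "1/2" u v] by simp
    finally have mid: "ennreal s < f ((u + v) / 2)" by (simp add: field_simps)
    \<comment> \<open>At least one endpoint joins the midpoint in the superlevel set, and these two
      points are |z| apart.\<close>
    have "mean_of_order \<alpha> (f u) (f v) (1/2) \<le> max (f u) (f v)"
      using assms by (intro mean_of_order_le_max) auto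
    with uv(3) have "ennreal s < f u \<or> ennreal s < f v"
      by (meson less_le_trans less_max_iff_disj)
    then have "ennreal \<bar>z\<bar> \<le> emeasure lborel {x. ennreal s < f x}"
    proof
      assume "ennreal s < f u"
      moreover have "u - (u + v) / 2 = \<bar>z\<bar>" using uv by (simp add: field_simps)
      ultimately show ?thesis
        using emeasure_superlevel_ge[OF qc mid, of u] uv by simp
    next
      assume "ennreal s < f v"
      moreover have "(u + v) / 2 - v = \<bar>z\<bar>" using uv by (simp add: field_simps)
      ultimately show ?thesis
        using emeasure_superlevel_ge[OF qc _ mid, of v] uv by simp
    qed
    then show "ennreal \<bar>z\<bar> \<le> 1 * emeasure lborel {x. ennreal s < f x}" by simp
  qed
  then show ?thesis by simp
qed

lemma nn_integral_difference_function_le_powr: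
  assumes "\<alpha> < 0" "alpha_concave \<alpha> f"
  shows "(\<integral>\<^sup>+x. difference_function \<alpha> f x \<partial>lborel)
    \<le> ennreal (1 / 2 powr (1 / \<alpha>)) * (\<integral>\<^sup>+x. f x \<partial>lborel)"
proof -
  have qc: "quasi_concave f" using assms by (rule alpha_concave_imp_quasi_concave)
  then have [measurable]: "f \<in> borel_measurable borel" by (rule quasi_concave_borel_measurable)
  define c where "c = 1 / 2 powr (1 / \<alpha>)"
  have c: "c > 0" by (simp add: c_def)
  have qc': "quasi_concave (\<lambda>x. ennreal c * f x)"
    unfolding quasi_concave_def
  proof
    fix s
    \<comment> \<open>Scaling \<open>f\<close> by \<open>c\<close> only relabels the levels of its
      superlevel sets.\<close>
    have "s < ennreal c * f x \<longleftrightarrow> s / ennreal c < f x" for x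
      using c divide_less_ennreal[of "ennreal c" s "f x"]
      by (simp add: mult.commute ennreal_eq_0_iff)
    then show "convex {x. s < ennreal c * f x}"
      using qc by (simp add: quasi_concave_def)
  qed
  have half: "2 * ennreal (1/2) = 1"
    by (simp flip: divide_ennreal_def)
  \<comment> \<open>The bound is applied to \<open>c\<close> times \<open>f\<close> with
    \<open>C = 1/2\<close>: both endpoints, 2|z| apart, lie in its superlevel set. The factors 2 and
    1/2 cancel and \<open>c\<close> remains.\<close>
  have "(\<integral>\<^sup>+x. difference_function \<alpha> f x \<partial>lborel)
      \<le> 2 * ennreal (1/2) * (\<integral>\<^sup>+x. ennreal c * f x \<partial>lborel)"
  proof (rule nn_integral_le_of_symmetric_superlevel_bound)
    fix s z assume "ennreal s < difference_function \<alpha> f z"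
    then obtain u v where uv: "v \<le> u" "u - v = 2 * \<bar>z\<bar>"
      "ennreal s < mean_of_order \<alpha> (f u) (f v) (1/2)"
      by (rule difference_function_greaterE)
    have "ennreal s < ennreal c * f u" "ennreal s < ennreal c * f v"
      using uv(3) mean_of_order_half_le_cmult[OF assms(1), of "f u" "f v"]
        mean_of_order_half_le_cmult[OF assms(1), of "f v" "f u"]
      by (auto simp: c_def mean_of_order_half_commute[of \<alpha> "f v" "f u"] intro: less_le_trans)
    then have "ennreal (2 * \<bar>z\<bar>) \<le> emeasure lborel {x. ennreal s < ennreal c * f x}"
      using emeasure_superlevel_ge[OF qc', of "ennreal s" v u] uv by simp
    then have "ennreal (1/2) * ennreal (2 * \<bar>z\<bar>)
        \<le> ennreal (1/2) * emeasure lborel {x. ennreal s < ennreal c * f x}"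
      by (rule mult_left_mono) simp
    then show "ennreal \<bar>z\<bar> \<le> ennreal (1/2) * emeasure lborel {x. ennreal s < ennreal c * f x}"
      using ennreal_mult[of "1/2" "2 * \<bar>z\<bar>"] by (simp del: ennreal_half)
  qed measurable
  then show ?thesis
    by (simp add: half nn_integral_cmult c_def del: ennreal_half)
qed

section \<open>Extremal functions\<close>

text \<open>One family for all extremal examples: for \<open>e \<ge> 0\<close> and \<open>J\<close>
  in the half-line, the \<alpha>-th power is affine on \<open>J\<close> and infinite outside. With
  \<open>e = 0\<close> the value at 0 is infinity.\<close>

definition shifted_power :: "real \<Rightarrow> real \<Rightarrow> real set \<Rightarrow> real \<Rightarrow> ennreal" where
  "shifted_power \<alpha> e J x = (if x \<in> J then ennreal_neg_powr (ennreal (e + x)) (1 / \<alpha>) else 0)"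

lemma shifted_power_powr:
  assumes "\<alpha> < 0" "x \<in> J"
  shows "shifted_power \<alpha> e J x \<noteq> 0"
    and "ennreal_neg_powr (shifted_power \<alpha> e J x) \<alpha> = ennreal (e + x)"
  using assms ennreal_neg_powr_inverse[of "1 / \<alpha>" "ennreal (e + x)"]
  by (auto simp: shifted_power_def ennreal_neg_powr_def ennreal_eq_0_iff split: if_splits)

text \<open>The \<alpha>-th powers are affine in the point, so averaging them amounts to averaging
  the points.\<close>

lemma mean_of_order_shifted_power:
  assumes "\<alpha> < 0" "x \<in> J" "y \<in> J" "t \<in> {0..1}" "e \<ge> 0" "J \<subseteq> {0..}"
  shows "mean_of_order \<alpha> (shifted_power \<alpha> e J x) (shifted_power \<alpha> e J y) t
    = ennreal_neg_powr (ennreal (e + (t * x + (1 - t) * y))) (1 / \<alpha>)"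
proof -
  have "0 \<le> x" "0 \<le> y" using assms by auto
  then have "ennreal t * ennreal (e + x) + ennreal (1 - t) * ennreal (e + y)
      = ennreal (t * (e + x) + (1 - t) * (e + y))"
    using assms by (simp flip: ennreal_mult ennreal_plus)
  also have "t * (e + x) + (1 - t) * (e + y) = e + (t * x + (1 - t) * y)"
    by (simp add: algebra_simps)
  finally show ?thesis
    using assms by (simp add: mean_of_order_def shifted_power_powr)
qed

text \<open>For two points of \<open>J\<close> the defining inequality is an equality; otherwise the
  mean is 0.\<close>

lemma alpha_concave_shifted_power:
  assumes "\<alpha> < 0" "e \<ge> 0" "J \<subseteq> {0..}" "convex J"
  shows "alpha_concave \<alpha> (shifted_power \<alpha> e J)"
  unfolding alpha_concave_def
proof (intro allI ballI)
  fix x y t :: real assume t: "t \<in> {0..1}"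
  show "mean_of_order \<alpha> (shifted_power \<alpha> e J x) (shifted_power \<alpha> e J y) t
      \<le> shifted_power \<alpha> e J (t * x + (1 - t) * y)"
  proof (cases "x \<in> J \<and> y \<in> J")
    case True
    then have "t * x + (1 - t) * y \<in> J"
      using convexD[OF assms(4), of x y t "1 - t"] t by auto
    then show ?thesis
      using True t assms by (simp add: mean_of_order_shifted_power) (simp add: shifted_power_def)
  qed (auto simp: shifted_power_def mean_of_order_def)
qed

text \<open>The supremum is tested with a single pair of points of \<open>J\<close>, namely 0 and
  2|z|.\<close>

lemma difference_function_shifted_power_ge:
  assumes "\<alpha> < 0" "e \<ge> 0" "J \<subseteq> {0..}" "0 \<in> J"
  shows "(if 2 * \<bar>z\<bar> \<in> J then ennreal_neg_powr (ennreal (e + \<bar>z\<bar>)) (1 / \<alpha>) else 0)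
    \<le> difference_function \<alpha> (shifted_power \<alpha> e J) z"
proof (cases "2 * \<bar>z\<bar> \<in> J")
  case True
  \<comment> \<open>For either sign of \<open>z\<close>, the points \<open>x\<close> and
    \<open>-y\<close> are 0 and 2|z| in some order.\<close>
  define x y where "x = (if z \<ge> 0 then 2 * z else 0)" and "y = (if z \<ge> 0 then 0 else 2 * z)"
  have "(x + y) / 2 = z" by (simp add: x_def y_def)
  then have "mean_of_order \<alpha> (shifted_power \<alpha> e J x) (shifted_power \<alpha> e J (- y)) (1/2)
      \<le> difference_function \<alpha> (shifted_power \<alpha> e J) z"
    unfolding difference_function_def
    by (intro Sup_upper) blast
  moreover have "mean_of_order \<alpha> (shifted_power \<alpha> e J x) (shifted_power \<alpha> e J (- y)) (1/2)
      = ennreal_neg_powr (ennreal (e + (1/2 * x + (1 - 1/2) * (-y)))) (1 / \<alpha>)"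
    using True assms by (intro mean_of_order_shifted_power) (auto simp: x_def y_def)
  moreover have "1/2 * x + (1 - 1/2) * (-y) = \<bar>z\<bar>"
    by (simp add: x_def y_def)
  ultimately show ?thesis using True by simp
qed simp

lemma nn_integral_even:
  fixes h :: "real \<Rightarrow> ennreal"
  assumes [measurable]: "h \<in> borel_measurable borel"
  shows "(\<integral>\<^sup>+z. h \<bar>z\<bar> \<partial>lborel) = 2 * (\<integral>\<^sup>+z. h z * indicator {0..} z \<partial>lborel)"
proof -
  have "(\<integral>\<^sup>+z. h \<bar>z\<bar> * indicator {..<0} z \<partial>lborel)
      = (\<integral>\<^sup>+z. h \<bar>z\<bar> * indicator {..<0} (- z) \<partial>lborel)"
    using nn_integral_real_affine[of "\<lambda>z. h \<bar>z\<bar> * indicator {..<0} z" "-1" 0] by simp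
  \<comment> \<open>After the reflection the integrands can differ only at 0, a null set.\<close>
  also have "\<dots> = (\<integral>\<^sup>+z. h z * indicator {0..} z \<partial>lborel)"
    by (rule nn_integral_cong_AE, rule AE_mp[OF AE_lborel_singleton[of 0]])
      (auto intro!: AE_I2 simp: indicator_def)
  finally have neg: "(\<integral>\<^sup>+z. h \<bar>z\<bar> * indicator {..<0} z \<partial>lborel)
      = (\<integral>\<^sup>+z. h z * indicator {0..} z \<partial>lborel)" .
  have "(\<integral>\<^sup>+z. h \<bar>z\<bar> \<partial>lborel)
      = (\<integral>\<^sup>+z. h z * indicator {0..} z + h \<bar>z\<bar> * indicator {..<0} z \<partial>lborel)"
    by (rule nn_integral_cong) (auto simp: indicator_def)
  also have "\<dots> = (\<integral>\<^sup>+z. h z * indicator {0..} z \<partial>lborel) + (\<integral>\<^sup>+z. h \<bar>z\<bar> * indicator {..<0} z \<partial>lborel)"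
    by (rule nn_integral_add) measurable
  finally show ?thesis by (simp add: neg mult_2)
qed

lemma nn_integral_difference_function_shifted_power_ge:
  assumes "\<alpha> < 0" "e \<ge> 0" "J \<subseteq> {0..}" "0 \<in> J" and [measurable]: "J \<in> sets borel"
  shows "2 * (\<integral>\<^sup>+z. ennreal_neg_powr (ennreal (e + z)) (1 / \<alpha>) * indicator J (2 * z) \<partial>lborel)
    \<le> (\<integral>\<^sup>+z. difference_function \<alpha> (shifted_power \<alpha> e J) z \<partial>lborel)"
proof -
  let ?h = "\<lambda>z. ennreal_neg_powr (ennreal (e + z)) (1 / \<alpha>) * indicator J (2 * z)"
  \<comment> \<open>As \<open>J\<close> lies in the half-line, \<open>indicator J (2 * z)\<close>
    vanishes for negative \<open>z\<close>.\<close>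
  have "(\<integral>\<^sup>+z. ?h z \<partial>lborel) = (\<integral>\<^sup>+z. ?h z * indicator {0..} z \<partial>lborel)"
    using assms(3) by (intro nn_integral_cong) (force simp: indicator_def)
  then have "2 * (\<integral>\<^sup>+z. ?h z \<partial>lborel) = (\<integral>\<^sup>+z. ?h \<bar>z\<bar> \<partial>lborel)"
    by (subst nn_integral_even) simp_all
  also have "\<dots> \<le> (\<integral>\<^sup>+z. difference_function \<alpha> (shifted_power \<alpha> e J) z \<partial>lborel)"
  proof (rule nn_integral_mono)
    fix z
    show "?h \<bar>z\<bar> \<le> difference_function \<alpha> (shifted_power \<alpha> e J) z"
      using difference_function_shifted_power_ge[OF assms(1-4), of z]
      by (auto simp: indicator_def)
  qed
  finally show ?thesis .
qed

lemma shifted_power_altdef: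
  "shifted_power \<alpha> e J = (\<lambda>x. ennreal_neg_powr (ennreal (e + x)) (1 / \<alpha>) * indicator J x)"
  by (auto simp: shifted_power_def indicator_def)

text \<open>The half-line is invariant under doubling, so the lower bound for the difference
  function integrates to exactly twice the integral of the function.\<close>

lemma nn_integral_difference_function_pareto:
  assumes "\<alpha> < 0"
  shows "(\<integral>\<^sup>+x. difference_function \<alpha> (shifted_power \<alpha> 1 {0..}) x \<partial>lborel)
    = 2 * (\<integral>\<^sup>+x. shifted_power \<alpha> 1 {0..} x \<partial>lborel)"
proof (rule antisym)
  show "(\<integral>\<^sup>+x. difference_function \<alpha> (shifted_power \<alpha> 1 {0..}) x \<partial>lborel)
    \<le> 2 * (\<integral>\<^sup>+x. shifted_power \<alpha> 1 {0..} x \<partial>lborel)"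
    using assms by (intro nn_integral_difference_function_le_2 alpha_concave_shifted_power) auto
  have "indicator {0..} (2 * z) = (indicator {0..} z :: ennreal)" for z :: real
    by (auto simp: indicator_def)
  then show "2 * (\<integral>\<^sup>+x. shifted_power \<alpha> 1 {0..} x \<partial>lborel)
    \<le> (\<integral>\<^sup>+x. difference_function \<alpha> (shifted_power \<alpha> 1 {0..}) x \<partial>lborel)"
    using nn_integral_difference_function_shifted_power_ge[OF assms, of 1 "{0..}"]
    by (simp add: shifted_power_altdef)
qed

text \<open>With \<open>e = 0\<close> the power is homogeneous. Substituting x = 2z in the integral
  of the function turns the right-hand side into the lower bound for the left-hand side.\<close>

lemma nn_integral_difference_function_truncated_power:
  assumes "\<alpha> < 0"
  shows "(\<integral>\<^sup>+x. difference_function \<alpha> (shifted_power \<alpha> 0 {0..1}) x \<partial>lborel)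
    = ennreal (1 / 2 powr (1 / \<alpha>)) * (\<integral>\<^sup>+x. shifted_power \<alpha> 0 {0..1} x \<partial>lborel)"
proof (rule antisym)
  show "(\<integral>\<^sup>+x. difference_function \<alpha> (shifted_power \<alpha> 0 {0..1}) x \<partial>lborel)
    \<le> ennreal (1 / 2 powr (1 / \<alpha>)) * (\<integral>\<^sup>+x. shifted_power \<alpha> 0 {0..1} x \<partial>lborel)"
    using assms by (intro nn_integral_difference_function_le_powr alpha_concave_shifted_power) auto
  let ?c = "ennreal (1 / 2 powr (1 / \<alpha>))"
  \<comment> \<open>The constant is exactly what undoes the dilation by 2.\<close>
  have scale: "?c * ennreal_neg_powr (ennreal (2 * z)) (1 / \<alpha>) = ennreal_neg_powr (ennreal z) (1 / \<alpha>)" for z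
  proof -
    have "ennreal_neg_powr (ennreal (2 * z)) (1 / \<alpha>) = ennreal (2 powr (1 / \<alpha>)) * ennreal_neg_powr (ennreal z) (1 / \<alpha>)"
      using ennreal_neg_powr_cmult[of 2 "ennreal z" "1 / \<alpha>"] by (simp add: ennreal_mult')
    moreover have "?c * ennreal (2 powr (1 / \<alpha>)) = 1"
      by (simp flip: ennreal_mult)
    ultimately show ?thesis by (simp flip: mult.assoc)
  qed
  have "?c * (\<integral>\<^sup>+x. shifted_power \<alpha> 0 {0..1} x \<partial>lborel)
      = ?c * (2 * (\<integral>\<^sup>+z. shifted_power \<alpha> 0 {0..1} (2 * z) \<partial>lborel))"
    by (subst nn_integral_real_affine[where c = 2 and t = 0]) (simp_all add: shifted_power_altdef)
  also have "\<dots> = 2 * (\<integral>\<^sup>+z. ?c * shifted_power \<alpha> 0 {0..1} (2 * z) \<partial>lborel)"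
    by (subst nn_integral_cmult) (simp_all add: shifted_power_altdef mult_ac)
  also have "\<dots> = 2 * (\<integral>\<^sup>+z. ennreal_neg_powr (ennreal (0 + z)) (1 / \<alpha>) * indicator {0..1} (2 * z) \<partial>lborel)"
    by (simp add: shifted_power_altdef scale flip: mult.assoc)
  also have "\<dots> \<le> (\<integral>\<^sup>+x. difference_function \<alpha> (shifted_power \<alpha> 0 {0..1}) x \<partial>lborel)"
    using assms by (intro nn_integral_difference_function_shifted_power_ge) auto
  finally show "?c * (\<integral>\<^sup>+x. shifted_power \<alpha> 0 {0..1} x \<partial>lborel)
    \<le> (\<integral>\<^sup>+x. difference_function \<alpha> (shifted_power \<alpha> 0 {0..1}) x \<partial>lborel)" .
qed

section \<open>Integrals of the extremal functions and sharpness of the constants\<close>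

text \<open>The exponent is below -1, so the tail is integrable, and the shift by 1 avoids the
  singularity at 0. A positive finite integral can be cancelled when constants are compared.\<close>

lemma nn_integral_pareto:
  assumes "\<alpha> \<in> {-1<..<0}"
  shows "0 < (\<integral>\<^sup>+x. shifted_power \<alpha> 1 {0..} x \<partial>lborel)"
    and "(\<integral>\<^sup>+x. shifted_power \<alpha> 1 {0..} x \<partial>lborel) < \<infinity>"
proof -
  define p where "p = 1 / \<alpha>"
  have p: "p < -1" using assms by (auto simp: p_def field_simps)
  have "((\<lambda>x. x powr p) has_integral -(1 powr (p + 1)) / (p + 1)) {1..}"
    using p by (intro has_integral_powr_to_inf) auto
  then have I: "(\<integral>\<^sup>+x. ennreal (x powr p) * indicator {1..} x \<partial>lborel) = ennreal (-1 / (p + 1))"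
    by (subst nn_integral_has_integral_lebesgue') auto
  have "(\<integral>\<^sup>+x. ennreal (x powr p) * indicator {1..} x \<partial>lborel)
      = (\<integral>\<^sup>+x. ennreal ((1 + x) powr p) * indicator {1..} (1 + x) \<partial>lborel)"
    by (subst nn_integral_real_affine[where c = 1 and t = 1]) simp_all
  also have "\<dots> = (\<integral>\<^sup>+x. shifted_power \<alpha> 1 {0..} x \<partial>lborel)"
    by (intro nn_integral_cong)
      (auto simp: shifted_power_def ennreal_neg_powr_def p_def indicator_def simp del: ennreal_plus)
  finally have "(\<integral>\<^sup>+x. shifted_power \<alpha> 1 {0..} x \<partial>lborel) = ennreal (-1 / (p + 1))"
    using I by simp
  moreover have "-1 / (p + 1) > 0" using p by (simp add: field_simps)
  ultimately show "0 < (\<integral>\<^sup>+x. shifted_power \<alpha> 1 {0..} x \<partial>lborel)"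
    and "(\<integral>\<^sup>+x. shifted_power \<alpha> 1 {0..} x \<partial>lborel) < \<infinity>"
    by (simp_all del: minus_divide_left)
qed

text \<open>The exponent lies strictly between -1 and 0, so the singularity at 0 is
  integrable.\<close>

lemma nn_integral_truncated_power:
  assumes "\<alpha> < -1"
  shows "0 < (\<integral>\<^sup>+x. shifted_power \<alpha> 0 {0..1} x \<partial>lborel)"
    and "(\<integral>\<^sup>+x. shifted_power \<alpha> 0 {0..1} x \<partial>lborel) < \<infinity>"
proof -
  define p where "p = 1 / \<alpha>"
  have p: "p > -1" using assms by (auto simp: p_def field_simps)
  have "((\<lambda>x. x powr p) has_integral (1 powr (p + 1)) / (p + 1)) {0..1}"
    using p by (intro has_integral_powr_from_0) auto
  then have "(\<integral>\<^sup>+x. ennreal (x powr p) * indicator {0..1} x \<partial>lborel) = ennreal (1 / (p + 1))"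
    by (subst nn_integral_has_integral_lebesgue') auto
  \<comment> \<open>At 0 the real power is 0 by default while \<open>shifted_power\<close> is
    infinite, so the integrands agree only almost everywhere.\<close>
  also have "(\<integral>\<^sup>+x. ennreal (x powr p) * indicator {0..1} x \<partial>lborel)
      = (\<integral>\<^sup>+x. shifted_power \<alpha> 0 {0..1} x \<partial>lborel)"
    by (rule nn_integral_cong_AE, rule AE_mp[OF AE_lborel_singleton[of 0]])
      (auto intro!: AE_I2 simp: shifted_power_def ennreal_neg_powr_def p_def indicator_def ennreal_eq_0_iff)
  finally have "(\<integral>\<^sup>+x. shifted_power \<alpha> 0 {0..1} x \<partial>lborel) = ennreal (1 / (p + 1))" .
  then show "0 < (\<integral>\<^sup>+x. shifted_power \<alpha> 0 {0..1} x \<partial>lborel)"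
    and "(\<integral>\<^sup>+x. shifted_power \<alpha> 0 {0..1} x \<partial>lborel) < \<infinity>"
    using p by simp_all
qed

text \<open>The exponent is written \<open>1 / - 1\<close> to match \<open>1 / \<alpha>\<close> at
  \<alpha> = -1.\<close>

lemma nn_integral_shifted_reciprocal:
  assumes "a \<ge> 0"
  shows "(\<integral>\<^sup>+x. ennreal_neg_powr (ennreal (1 + x)) (1 / - 1) * indicator {0..a} x \<partial>lborel)
    = ennreal (ln (1 + a))"
proof -
  have "(\<integral>\<^sup>+x. ennreal_neg_powr (ennreal (1 + x)) (1 / - 1) * indicator {0..a} x \<partial>lborel)
      = (\<integral>\<^sup>+x. ennreal (1 / (1 + x)) * indicator {0..a} x \<partial>lborel)"
    by (intro nn_integral_cong)
      (auto simp: ennreal_neg_powr_def indicator_def powr_minus_divide ennreal_eq_0_iff)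
  also have "\<dots> = ennreal (ln (1 + a) - ln (1 + 0))"
    using assms by (intro nn_integral_FTC_Icc[where F = "\<lambda>x. ln (1 + x)"])
      (auto intro!: derivative_eq_intros)
  finally show ?thesis by simp
qed

text \<open>The extremal function \<open>1/x\<close> on \<open>[0,1]\<close> for order \<open>-1\<close> is not integrable, so optimality is
  obtained in the limit from \<open>1/(1+x)\<close> on \<open>[0,a]\<close> with \<open>a = exp X - 1\<close>.\<close>
lemma two_le_difference_constant_of_order_minus_one:
  fixes c :: ennreal
  assumes c: "\<And>f. alpha_concave (-1) f \<Longrightarrow>
    (\<integral>\<^sup>+x. difference_function (-1) f x \<partial>lborel) \<le> c * (\<integral>\<^sup>+x. f x \<partial>lborel)"
  shows "2 \<le> c"
proof (cases c)
  case (real r)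
  have ineq: "2 * (X - ln 2) \<le> r * X" if X: "X > 0" for X :: real
  proof -
    define a where "a = exp X - 1"
    have a: "a \<ge> 0" "1 + a = exp X" using X by (auto simp: a_def)
    have ind: "indicator {0..a} (2 * z) = (indicator {0..a/2} z :: ennreal)" for z
      by (auto simp: indicator_def)
    have "2 * ennreal (ln (1 + a/2))
        \<le> (\<integral>\<^sup>+x. difference_function (-1) (shifted_power (-1) 1 {0..a}) x \<partial>lborel)"
      using nn_integral_difference_function_shifted_power_ge[of "-1" 1 "{0..a}"] a
        nn_integral_shifted_reciprocal[of "a/2"]
      by (simp add: ind)
    also have "\<dots> \<le> c * (\<integral>\<^sup>+x. shifted_power (-1) 1 {0..a} x \<partial>lborel)"
      using a by (intro c alpha_concave_shifted_power) auto
    also have "\<dots> = c * ennreal (ln (1 + a))"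
      using nn_integral_shifted_reciprocal[of a] a by (simp add: shifted_power_altdef)
    also have "\<dots> = ennreal (r * X)"
      using real X a by (simp add: ennreal_mult)
    also have "2 * ennreal (ln (1 + a/2)) = ennreal (2 * ln (1 + a/2))"
      by (simp add: ennreal_mult')
    finally have "2 * ln (1 + a/2) \<le> r * X"
      using real X by (simp add: ennreal_le_iff)
    \<comment> \<open>\<open>1 + a/2\<close> equals (1 + exp X)/2, so halving the interval costs at
      most ln 2, negligible against \<open>X\<close> as \<open>X\<close> grows.\<close>
    moreover have "ln (exp X / 2) \<le> ln (1 + a/2)"
      using a by (intro iffD2[OF ln_le_cancel_iff]) (auto simp: a_def field_simps intro: add_pos_pos)
    ultimately show ?thesis by (simp add: ln_div)
  qed
  have "2 \<le> r"
  proof (rule ccontr)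
    assume r: "\<not> 2 \<le> r"
    \<comment> \<open>\<open>ineq\<close> says (2 - r) X \<le> 2 ln 2; this \<open>X\<close> exceeds
      that threshold by 1.\<close>
    define X where "X = 2 * ln 2 / (2 - r) + 1"
    have "X > 0" using r by (auto simp: X_def intro!: add_nonneg_pos divide_nonneg_pos)
    moreover have "(2 - r) * X = 2 * ln 2 + (2 - r)"
      using r by (simp add: X_def field_simps)
    ultimately show False using ineq[of X] r by (simp add: algebra_simps)
  qed
  then show ?thesis using real by (simp flip: ennreal_numeral)
qed simp

lemma ennreal_le_of_mult_le:
  fixes a b c :: ennreal
  assumes "a * x \<le> c * x" "0 < x" "x < \<infinity>"
  shows "a \<le> c"
proof -
  have "a * x / x \<le> c * x / x" by (rule divide_right_mono_ennreal) fact
  then show ?thesis using assms by (simp add: mult_divide_eq_ennreal)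
qed

text \<open>Equality alone also holds for f = 0 or between infinite integrals. Optimality therefore
  includes that no smaller constant \<open>c\<close> works for all \<alpha>-concave
  functions.\<close>

theorem theorem5p1:
  shows
    "(\<forall>\<alpha>::real. \<forall>f. \<alpha> < 0 \<and> alpha_concave \<alpha> f \<longrightarrow>
        (\<alpha> \<in> {-1<..<0} \<longrightarrow>
          (\<integral>\<^sup>+x. difference_function \<alpha> f x \<partial>lborel) \<le> 2 * (\<integral>\<^sup>+x. f x \<partial>lborel)) \<and>
        (\<alpha> \<in> {..-1} \<longrightarrow>
          (\<integral>\<^sup>+x. difference_function \<alpha> f x \<partial>lborel)
            \<le> ennreal (1 / 2 powr (1 / \<alpha>)) * (\<integral>\<^sup>+x. f x \<partial>lborel))) \<and>
     (\<forall>\<alpha>::real. \<alpha> \<in> {-1<..<0} \<longrightarrow>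
        (\<exists>f. alpha_concave \<alpha> f \<and>
          (\<integral>\<^sup>+x. difference_function \<alpha> f x \<partial>lborel) = 2 * (\<integral>\<^sup>+x. f x \<partial>lborel)) \<and>
        (\<forall>c::ennreal.
          (\<forall>f. alpha_concave \<alpha> f \<longrightarrow>
            (\<integral>\<^sup>+x. difference_function \<alpha> f x \<partial>lborel) \<le> c * (\<integral>\<^sup>+x. f x \<partial>lborel))
          \<longrightarrow> 2 \<le> c)) \<and>
     (\<forall>\<alpha>::real. \<alpha> \<in> {..-1} \<longrightarrow>
        (\<exists>f. alpha_concave \<alpha> f \<and>
          (\<integral>\<^sup>+x. difference_function \<alpha> f x \<partial>lborel)
            = ennreal (1 / 2 powr (1 / \<alpha>)) * (\<integral>\<^sup>+x. f x \<partial>lborel)) \<and>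
        (\<forall>c::ennreal.
          (\<forall>f. alpha_concave \<alpha> f \<longrightarrow>
            (\<integral>\<^sup>+x. difference_function \<alpha> f x \<partial>lborel) \<le> c * (\<integral>\<^sup>+x. f x \<partial>lborel))
          \<longrightarrow> ennreal (1 / 2 powr (1 / \<alpha>)) \<le> c))"

proof (intro conjI allI impI)
  fix \<alpha> :: real and f
  assume *: "\<alpha> < 0 \<and> alpha_concave \<alpha> f"
  show "(\<integral>\<^sup>+x. difference_function \<alpha> f x \<partial>lborel) \<le> 2 * (\<integral>\<^sup>+x. f x \<partial>lborel)"
    using * by (intro nn_integral_difference_function_le_2) auto
  show "(\<integral>\<^sup>+x. difference_function \<alpha> f x \<partial>lborel)
      \<le> ennreal (1 / 2 powr (1 / \<alpha>)) * (\<integral>\<^sup>+x. f x \<partial>lborel)"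
    using * by (intro nn_integral_difference_function_le_powr) auto
next
  fix \<alpha> :: real
  assume \<alpha>: "\<alpha> \<in> {-1<..<0}"
  let ?f = "shifted_power \<alpha> 1 {0..}"
  have f: "alpha_concave \<alpha> ?f"
    using \<alpha> by (intro alpha_concave_shifted_power) auto
  have eq: "(\<integral>\<^sup>+x. difference_function \<alpha> ?f x \<partial>lborel) = 2 * (\<integral>\<^sup>+x. ?f x \<partial>lborel)"
    using \<alpha> by (intro nn_integral_difference_function_pareto) auto
  show "\<exists>f. alpha_concave \<alpha> f \<and>
      (\<integral>\<^sup>+x. difference_function \<alpha> f x \<partial>lborel) = 2 * (\<integral>\<^sup>+x. f x \<partial>lborel)"
    using f eq by blast
  fix c :: ennreal
  assume "\<forall>f. alpha_concave \<alpha> f \<longrightarrow>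
      (\<integral>\<^sup>+x. difference_function \<alpha> f x \<partial>lborel) \<le> c * (\<integral>\<^sup>+x. f x \<partial>lborel)"
  with f eq have "2 * (\<integral>\<^sup>+x. ?f x \<partial>lborel) \<le> c * (\<integral>\<^sup>+x. ?f x \<partial>lborel)"
    by metis
  then show "2 \<le> c"
    using nn_integral_pareto[OF \<alpha>] by (rule ennreal_le_of_mult_le)
next
  fix \<alpha> :: real
  assume \<alpha>: "\<alpha> \<in> {..-1}"
  let ?f = "shifted_power \<alpha> 0 {0..1}"
  have f: "alpha_concave \<alpha> ?f"
    using \<alpha> by (intro alpha_concave_shifted_power) auto
  have eq: "(\<integral>\<^sup>+x. difference_function \<alpha> ?f x \<partial>lborel)
      = ennreal (1 / 2 powr (1 / \<alpha>)) * (\<integral>\<^sup>+x. ?f x \<partial>lborel)"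
    using \<alpha> by (intro nn_integral_difference_function_truncated_power) auto
  show "\<exists>f. alpha_concave \<alpha> f \<and> (\<integral>\<^sup>+x. difference_function \<alpha> f x \<partial>lborel)
      = ennreal (1 / 2 powr (1 / \<alpha>)) * (\<integral>\<^sup>+x. f x \<partial>lborel)"
    using f eq by blast
  fix c :: ennreal
  assume c: "\<forall>f. alpha_concave \<alpha> f \<longrightarrow>
      (\<integral>\<^sup>+x. difference_function \<alpha> f x \<partial>lborel) \<le> c * (\<integral>\<^sup>+x. f x \<partial>lborel)"
  show "ennreal (1 / 2 powr (1 / \<alpha>)) \<le> c"
  \<comment> \<open>At \<alpha> = -1 the extremal function has infinite integral and cannot be
    cancelled; the constant there is 2, reached by the limiting argument.\<close>
  proof (cases "\<alpha> = -1")
    case True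
    then have "2 \<le> c"
      using c by (intro two_le_difference_constant_of_order_minus_one) auto
    then show ?thesis
      using True by (simp add: powr_minus_divide)
  next
    case False
    with \<alpha> have "\<alpha> < -1" by auto
    from c f eq have "ennreal (1 / 2 powr (1 / \<alpha>)) * (\<integral>\<^sup>+x. ?f x \<partial>lborel)
        \<le> c * (\<integral>\<^sup>+x. ?f x \<partial>lborel)"
      by metis
    then show ?thesis
      using nn_integral_truncated_power[OF \<open>\<alpha> < -1\<close>] by (rule ennreal_le_of_mult_le)
  qed
qed

end
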